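(* Let $v_1<\dots<v_m$ be non-negative packet values. For every deterministic online algorithm ALG for the buffer management problem with class segregation, there exist a queue configuration and an input sequence $\sigma$ such that $$\frac{\mathrm{OPT}(\sigma)}{\mathrm{ALG}(\sigma)}\ge 2-\frac{v_m}{\sum_{i=1}^m v_i};$$ in particular, the competitive ratio of any deterministic online algorithm is at least $2-v_m/\sum_{i=1}^m v_i$.
   Context: Model (buffer management with class segregation): there is a set of queues, each assigned one value from $\{v_1,\dots,v_m\}$ and having a capacity; a queue of value $v_i$ stores only $v_i$-packets. Time is discretized into unit steps. Packets arrive over time (at non-integral times), chosen by an adversary, each with a value and a destination queue of that value, and are either admitted (only if the destination queue has residual capacity) or rejected. At the end of each time step (send event) at most one packet from a non-empty queue is transmitted. The benefit is the total value of transmitted packets. $\mathrm{OPT}(\sigma)$ is the maximum benefit achievable by an offline algorithm knowing $\sigma$ in advance. An online algorithm is $c$-competitive if $\mathrm{OPT}(\sigma)/\mathrm{ALG}(\sigma)\le c$ for every input sequence $\sigma$. *)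

theory Defs
  imports Complex_Main "HOL-Library.Extended_Real"
begin

text \<open>
  Packet values are given by a function \<open>v\<close> on the class indices \<open>1, \<dots>, m\<close>.
  A queue configuration is a list of queues, and queues are referred to by their position in it.
\<close>

record queue =
  qclass :: nat
  capacity :: nat

definition queue_config :: "nat \<Rightarrow> queue list \<Rightarrow> bool" where
  "queue_config m C \<longleftrightarrow> (\<forall>q \<in> set C. qclass q \<in> {1..m} \<and> 0 < capacity q)"

definition queue_value :: "(nat \<Rightarrow> real) \<Rightarrow> queue list \<Rightarrow> nat \<Rightarrow> real" where
  "queue_value v C q = v (qclass (C ! q))"

text \<open>
  A queue stores packets of its own value only, so the value of a packet is that of its
  destination queue and is not recorded separately.
\<close>

record packet =
  arr :: real
  dest :: nat

text \<open>Simultaneous arrivals are allowed; the list order is then the order of processing.\<close>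

definition input_sequence :: "queue list \<Rightarrow> packet list \<Rightarrow> bool" where
  "input_sequence C \<sigma> \<longleftrightarrow>
     sorted (map arr \<sigma>) \<and>
     (\<forall>p \<in> set \<sigma>. 0 < arr p \<and> arr p \<notin> \<int> \<and> dest p < length C)"

definition arrived :: "packet list \<Rightarrow> real \<Rightarrow> packet list" where
  "arrived \<sigma> t = takeWhile (\<lambda>p. arr p \<le> t) \<sigma>"

text \<open>
  A schedule lists the positions in the input of the admitted packets and, for every integral
  time \<open>n\<close>, the queue (if any) served by the send event at time \<open>n\<close>. Time step \<open>n \<ge> 1\<close> is the
  interval from \<open>n - 1\<close> to \<open>n\<close>. All queues are empty at time \<open>0\<close>, so
  feasibility forces \<open>send s 0 = None\<close>.
\<close>

record schedule =
  admit :: "nat set"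
  send :: "nat \<Rightarrow> nat option"

text \<open>Number of packets in queue \<open>q\<close> after the first \<open>k\<close> arrivals and all send events before time \<open>t\<close>.\<close>

definition backlog :: "packet list \<Rightarrow> schedule \<Rightarrow> nat \<Rightarrow> nat \<Rightarrow> real \<Rightarrow> int" where
  "backlog \<sigma> s q k t =
     int (card {j \<in> admit s. j < k \<and> dest (\<sigma> ! j) = q})
     - int (card {n. real n < t \<and> send s n = Some q})"

definition feasible :: "queue list \<Rightarrow> packet list \<Rightarrow> schedule \<Rightarrow> bool" where
  "feasible C \<sigma> s \<longleftrightarrow>
     admit s \<subseteq> {..<length \<sigma>} \<and>
     (\<forall>i \<in> admit s.
        backlog \<sigma> s (dest (\<sigma> ! i)) i (arr (\<sigma> ! i)) < int (capacity (C ! dest (\<sigma> ! i)))) \<and>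
     (\<forall>n q. send s n = Some q \<longrightarrow>
        q < length C \<and> 0 < backlog \<sigma> s q (length (arrived \<sigma> (real n))) (real n))"

text \<open>For a feasible schedule the index set of the sum is finite, since \<open>\<sigma>\<close> is.\<close>

definition benefit :: "(nat \<Rightarrow> real) \<Rightarrow> queue list \<Rightarrow> schedule \<Rightarrow> real" where
  "benefit v C s = (\<Sum>n | send s n \<noteq> None. queue_value v C (the (send s n)))"

text \<open>
  The supremum is a maximum: for a fixed input, feasible schedules attain only finitely many
  benefits.
\<close>

definition OPT :: "(nat \<Rightarrow> real) \<Rightarrow> queue list \<Rightarrow> packet list \<Rightarrow> ereal" where
  "OPT v C \<sigma> = (SUP s \<in> {s. feasible C \<sigma> s}. ereal (benefit v C s))"

text \<open>
  A deterministic algorithm maps a configuration and an input to a feasible schedule. It is online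
  if its decisions up to any time \<open>t\<close> are determined by the packets arriving up to time \<open>t\<close>.
\<close>

definition online_algorithm :: "nat \<Rightarrow> (queue list \<Rightarrow> packet list \<Rightarrow> schedule) \<Rightarrow> bool" where
  "online_algorithm m ALG \<longleftrightarrow>
     (\<forall>C \<sigma>. queue_config m C \<and> input_sequence C \<sigma> \<longrightarrow> feasible C \<sigma> (ALG C \<sigma>)) \<and>
     (\<forall>C \<sigma> \<tau> t. queue_config m C \<and> input_sequence C \<sigma> \<and> input_sequence C \<tau> \<and>
        arrived \<sigma> t = arrived \<tau> t \<longrightarrow>
          (\<forall>i < length (arrived \<sigma> t). i \<in> admit (ALG C \<sigma>) \<longleftrightarrow> i \<in> admit (ALG C \<tau>)) \<and>
          (\<forall>n. real n \<le> t \<longrightarrow> send (ALG C \<sigma>) n = send (ALG C \<tau>) n))"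

text \<open>
  The quotient is taken in the extended reals, where \<open>x / 0 = \<infinity>\<close> for \<open>x > 0\<close> and \<open>0 / 0 = 0\<close>:
  an algorithm gaining nothing on an input of positive optimum has infinite ratio, and inputs
  whose optimum is \<open>0\<close> are irrelevant for competitiveness.
\<close>

definition performance_ratio ::
  "(nat \<Rightarrow> real) \<Rightarrow> (queue list \<Rightarrow> packet list \<Rightarrow> schedule) \<Rightarrow> queue list \<Rightarrow> packet list \<Rightarrow> ereal" where
  "performance_ratio v ALG C \<sigma> = OPT v C \<sigma> / ereal (benefit v C (ALG C \<sigma>))"

definition competitive ::
  "nat \<Rightarrow> (nat \<Rightarrow> real) \<Rightarrow> real \<Rightarrow> (queue list \<Rightarrow> packet list \<Rightarrow> schedule) \<Rightarrow> bool" where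
  "competitive m v c ALG \<longleftrightarrow>
     (\<forall>C \<sigma>. queue_config m C \<and> input_sequence C \<sigma> \<longrightarrow> performance_ratio v ALG C \<sigma> \<le> ereal c)"

text \<open>Equal to \<open>\<infinity>\<close> if the algorithm is not \<open>c\<close>-competitive for any \<open>c\<close>.\<close>

definition competitive_ratio ::
  "nat \<Rightarrow> (nat \<Rightarrow> real) \<Rightarrow> (queue list \<Rightarrow> packet list \<Rightarrow> schedule) \<Rightarrow> ereal" where
  "competitive_ratio m v ALG = (INF c \<in> {c. competitive m v c ALG}. ereal c)"

end

theory Submission imports Defs begin

text \<open>
  Take one queue of capacity one per class and fill all of them in the first time step. After each
  send event, refill the most valuable queue that is still full for the algorithm: the algorithm
  must reject the packet, while an offline schedule that has just served that queue admits it.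
  If the algorithm admitted the set \<open>S\<close> of initial packets, this is repeated \<open>card S - 1\<close> times. As
  the algorithm empties at most one queue per step, the rejected packets are worth at least
  \<open>V(S) - max S\<close>. Afterwards the offline schedule still has all queues full, so with the total value
  \<open>V\<close> the ratio is at least \<open>(V + V(S) - v\<^sub>m) / V(S) \<ge> 2 - v\<^sub>m / V\<close>.
\<close>

text \<open>Queue positions start at 0 and classes at 1, hence \<open>v (Suc q)\<close> throughout.
  As positions are ordered by value, \<open>Max\<close> picks the most valuable queue.\<close>

definition unit_config :: "nat \<Rightarrow> queue list" where
  "unit_config m = map (\<lambda>i. \<lparr>qclass = Suc i, capacity = 1\<rparr>) [0..<m]"

text \<open>The initial packet for queue \<open>q\<close> has position \<open>q\<close> in the
  input. Refill \<open>t\<close> has position \<open>m + t\<close> and falls between the send events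
  \<open>t + 1\<close> and \<open>t + 2\<close>.\<close>

definition refill_input :: "nat \<Rightarrow> (nat \<Rightarrow> nat) \<Rightarrow> nat \<Rightarrow> packet list" where
  "refill_input m d l = map (\<lambda>q. \<lparr>arr = 1/2, dest = q\<rparr>) [0..<m] @
     map (\<lambda>t. \<lparr>arr = real t + 3/2, dest = d t\<rparr>) [0..<l]"

text \<open>Membership in \<open>admit s\<close> concerns input positions; below \<open>m\<close>
  these coincide with queues. A member of the set still holds its initial packet after send event
  \<open>t\<close>.\<close>

definition full_queues :: "nat \<Rightarrow> schedule \<Rightarrow> nat \<Rightarrow> nat set" where
  "full_queues m s t = {q \<in> admit s. q < m \<and> (\<forall>n\<le>t. send s n \<noteq> Some q)}"

text \<open>Event \<open>t + 1\<close> serves \<open>d t\<close>, making room for refill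
  \<open>t\<close> just before it arrives. The events \<open>l + 1\<close> to \<open>l + m\<close>
  then drain the queues, all of which are full.\<close>

definition refill_schedule :: "nat \<Rightarrow> (nat \<Rightarrow> nat) \<Rightarrow> nat \<Rightarrow> schedule" where
  "refill_schedule m d l = \<lparr>admit = {..<m + l},
     send = (\<lambda>n. if n = 0 then None else if n \<le> l then Some (d (n - 1))
                 else if n \<le> l + m then Some (n - l - 1) else None)\<rparr>"

section \<open>The configuration and the input\<close>

lemma length_unit_config [simp]: "length (unit_config m) = m"
  by (simp add: unit_config_def)

lemma queue_config_unit_config: "queue_config m (unit_config m)"
  by (auto simp: queue_config_def unit_config_def)

lemma capacity_unit_config: "q < m \<Longrightarrow> capacity (unit_config m ! q) = 1"
  by (simp add: unit_config_def)

lemma queue_value_unit_config: "q < m \<Longrightarrow> queue_value v (unit_config m) q = v (Suc q)"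
  by (simp add: unit_config_def queue_value_def)

lemma length_refill_input [simp]: "length (refill_input m d l) = m + l"
  by (simp add: refill_input_def)

lemma nth_refill_input:
  assumes "i < m + l"
  shows "refill_input m d l ! i =
    (if i < m then \<lparr>arr = 1/2, dest = i\<rparr> else \<lparr>arr = real (i - m) + 3/2, dest = d (i - m)\<rparr>)"
  using assms by (auto simp: refill_input_def nth_append)

lemma input_sequence_refill_input:
  assumes "\<And>t. d t < m"
  shows "input_sequence (unit_config m) (refill_input m d l)"
proof -
  have 1: "(1/2::real) \<notin> \<int>"
  proof
    assume "(1/2::real) \<in> \<int>"
    then obtain z where "1/2 = real_of_int z" by (rule Ints_cases)
    then have "real_of_int (2 * z) = real_of_int 1" by simp
    then show False by (simp only: of_int_eq_iff) presburger
  qed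
  have "real t + 3/2 \<notin> \<int>" for t
  proof
    assume "real t + 3/2 \<in> \<int>"
    then have "real t + 3/2 - (real t + 1) \<in> \<int>"
      by (intro Ints_diff Ints_add) auto
    with 1 show False by simp
  qed
  moreover have "sorted (map arr (refill_input m d l))"
    by (auto simp: sorted_iff_nth_mono nth_refill_input)
  ultimately show ?thesis
    using 1 assms by (auto simp: input_sequence_def refill_input_def)
qed

text \<open>Exactly the first \<open>t\<close> refills precede send event \<open>t + 1\<close>. An
  online algorithm therefore cannot let this event depend on \<open>d t\<close> or on
  \<open>l\<close>.\<close>

lemma arrived_refill_input:
  assumes "t \<le> l"
  shows "arrived (refill_input m d l) (real (Suc t)) = refill_input m d t"
proof -
  have l: "[0..<l] = [0..<t] @ [t..<l]"
    using assms by (metis le_add_diff_inverse le0 upt_add_eq_append)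
  have "refill_input m d l =
      refill_input m d t @ map (\<lambda>t. \<lparr>arr = real t + 3/2, dest = d t\<rparr>) [t..<l]"
    unfolding refill_input_def by (subst l) simp
  moreover have "\<forall>p\<in>set (refill_input m d t). arr p \<le> real (Suc t)"
    by (auto simp: refill_input_def)
  moreover have "takeWhile (\<lambda>p. arr p \<le> real (Suc t))
      (map (\<lambda>t. \<lparr>arr = real t + 3/2, dest = d t\<rparr>) [t..<l]) = []"
    by (cases "t < l") (auto simp: upt_conv_Cons)
  ultimately show ?thesis
    by (simp add: arrived_def)
qed

lemma arrived_refill_input_0: "arrived (refill_input m d l) 0 = []"
proof -
  have "arr p > 0" if "p \<in> set (refill_input m d l)" for p
    using that by (auto simp: refill_input_def)
  then show ?thesis
    by (cases "refill_input m d l") (auto simp: arrived_def not_le)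
qed

lemma refill_input_cong:
  "(\<And>t. t < l \<Longrightarrow> d t = e t) \<Longrightarrow> refill_input m d l = refill_input m e l"
  by (simp add: refill_input_def)

text \<open>Here \<open>f\<close> is the adversary's rule. It is well-founded because the input with
  \<open>t\<close> refills involves only the values of \<open>d\<close> below
  \<open>t\<close>.\<close>

lemma adaptive_refill_exists:
  fixes f :: "packet list \<Rightarrow> nat \<Rightarrow> nat"
  obtains d where "\<And>t. d t = f (refill_input m d t) t"
proof -
  \<comment> \<open>The recursion carries the whole function built so far, since the next value
    depends on all earlier ones; \<open>hist t\<close> is correct below \<open>t\<close>.\<close>
  define hist where "hist = rec_nat (\<lambda>_. 0::nat)
    (\<lambda>t h. h(t := f (refill_input m h t) t))"
  have hist_Suc: "hist (Suc t) = (hist t)(t := f (refill_input m (hist t) t) t)" for t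
    by (simp add: hist_def)
  define d where "d t = hist (Suc t) t" for t
  have "hist l t = d t" if "t < l" for l t
    using that by (induction l) (auto simp: hist_Suc d_def less_Suc_eq)
  then have "refill_input m (hist t) t = refill_input m d t" for t
    by (intro refill_input_cong)
  then have "d t = f (refill_input m d t) t" for t
    by (simp add: d_def hist_Suc)
  then show thesis by (rule that)
qed

section \<open>The offline schedule\<close>

lemma feasible_refill_schedule:
  assumes d: "\<And>t. d t < m"
  shows "feasible (unit_config m) (refill_input m d l) (refill_schedule m d l)"
proof -
  let ?\<sigma> = "refill_input m d l" and ?s = "refill_schedule m d l"
  have admitted: "card {j \<in> admit ?s. j < m + k \<and> dest (?\<sigma> ! j) = q} =
      Suc (card {t. t < k \<and> d t = q})" if "k \<le> l" "q < m" for k q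
  proof -
    have "{j \<in> admit ?s. j < m + k \<and> dest (?\<sigma> ! j) = q} =
        insert q ((+) m ` {t. t < k \<and> d t = q})" (is "?L = ?R")
    proof (rule set_eqI)
      fix j
      show "j \<in> ?L \<longleftrightarrow> j \<in> ?R"
      proof (cases "j < m")
        case True
        then show ?thesis using that by (auto simp: refill_schedule_def nth_refill_input)
      next
        case False
        then obtain t where "j = m + t" by (metis le_iff_add not_less)
        then show ?thesis using that by (auto simp: refill_schedule_def nth_refill_input)
      qed
    qed
    then show ?thesis using \<open>q < m\<close> by (auto simp: card_image card_insert_if)
  qed
  \<comment> \<open>The half-open range of \<open>x\<close> covers both the send event at
    \<open>k + 1\<close> and the refill arriving at \<open>k + 1/2\<close>.\<close>
  have sent: "card {n. real n < x \<and> send ?s n = Some q} = card {t. t < k \<and> d t = q}"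
    if "k \<le> l" "real k < x" "x \<le> real k + 1" for k q x
  proof -
    have "{n. real n < x \<and> send ?s n = Some q} = Suc ` {t. t < k \<and> d t = q}" (is "?L = ?R")
    proof (rule set_eqI)
      fix n
      have "real n < x \<longleftrightarrow> n \<le> k"
        using that by linarith
      then show "n \<in> ?L \<longleftrightarrow> n \<in> ?R"
        using that by (cases n) (auto simp: refill_schedule_def)
    qed
    then show ?thesis by (simp add: card_image)
  qed
  \<comment> \<open>Queue \<open>q\<close> is drained only at time \<open>l + q + 1\<close>, so all
    its earlier services belong to the refill phase.\<close>
  have sent_late: "card {n. real n < real (l + q + 1) \<and> send ?s n = Some q} =
      card {t. t < l \<and> d t = q}" for q
  proof -
    have "{n. real n < real (l + q + 1) \<and> send ?s n = Some q} = Suc ` {t. t < l \<and> d t = q}"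
      (is "?L = ?R")
    proof (rule set_eqI)
      fix n
      show "n \<in> ?L \<longleftrightarrow> n \<in> ?R"
        by (cases n) (auto simp: refill_schedule_def)
    qed
    then show ?thesis by (simp add: card_image)
  qed
  have "backlog ?\<sigma> ?s (dest (?\<sigma> ! i)) i (arr (?\<sigma> ! i)) <
      int (capacity (unit_config m ! dest (?\<sigma> ! i)))" if "i \<in> admit ?s" for i
  proof (cases "i < m")
    case True
    have "{j \<in> admit ?s. j < i \<and> dest (?\<sigma> ! j) = i} = {}"
      using True by (auto simp: nth_refill_input)
    then have "backlog ?\<sigma> ?s i i x \<le> 0" for x
      unfolding backlog_def by (simp only: card.empty)
    then have "backlog ?\<sigma> ?s i i (1/2) < 1"
      using zero_less_one order_le_less_trans by blast
    with True show ?thesis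
      by (simp add: nth_refill_input capacity_unit_config)
  next
    case False
    then obtain t where i: "i = m + t" by (metis le_iff_add not_less)
    with that have t: "t < l" by (simp add: refill_schedule_def)
    have "{u. u < Suc t \<and> d u = d t} = insert t {u. u < t \<and> d u = d t}"
      by auto
    then have "card {u. u < Suc t \<and> d u = d t} = Suc (card {u. u < t \<and> d u = d t})"
      by simp
    with t admitted[of t "d t"] sent[of "Suc t" "real t + 3/2" "d t"] d[of t]
    have "backlog ?\<sigma> ?s (d t) (m + t) (real t + 3/2) = 0"
      by (simp add: backlog_def)
    with t i d show ?thesis
      by (simp add: nth_refill_input capacity_unit_config)
  qed
  moreover have "q < m \<and> 0 < backlog ?\<sigma> ?s q (length (arrived ?\<sigma> (real n))) (real n)"
    if "send ?s n = Some q" for n q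
  \<comment> \<open>In both phases the refills of \<open>q\<close> and its earlier services cancel,
    so the backlog is 1, from the initial packet.\<close>
  proof (cases "n \<le> l")
    case True
    with that obtain t where n: "n = Suc t" and q: "q = d t"
      by (cases n) (auto simp: refill_schedule_def)
    show ?thesis
      unfolding n backlog_def
      using True n q d[of t] admitted[of t q] sent[of t "real (Suc t)" q]
      by (simp add: arrived_refill_input del: of_nat_Suc)
  next
    case False
    with that have n: "n = l + q + 1" and q: "q < m"
      by (auto simp: refill_schedule_def split: if_splits)
    have "arrived ?\<sigma> (real n) = ?\<sigma>"
      unfolding arrived_def
      by (rule takeWhile_eq_all_conv[THEN iffD2]) (auto simp: refill_input_def n)
    then show ?thesis
      unfolding backlog_def
      using n q admitted[of l q] sent_late[of q] by simp
  qed
  ultimately show ?thesis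
    by (simp add: feasible_def) (simp add: refill_schedule_def)
qed

lemma benefit_refill_schedule:
  assumes d: "\<And>t. d t < m"
  shows "benefit v (unit_config m) (refill_schedule m d l) =
    (\<Sum>t<l. v (Suc (d t))) + (\<Sum>q<m. v (Suc q))"
proof -
  let ?s = "refill_schedule m d l"
  let ?g = "\<lambda>n. queue_value v (unit_config m) (the (send ?s n))"
  have "{n. send ?s n \<noteq> None} = Suc ` {..<l} \<union> (\<lambda>q. Suc (l + q)) ` {..<m}" (is "?L = ?R")
  proof (rule set_eqI)
    fix n
    show "n \<in> ?L \<longleftrightarrow> n \<in> ?R"
    proof (cases "n \<le> l")
      case True
      then show ?thesis by (cases n) (auto simp: refill_schedule_def)
    next
      case False
      then have "n = Suc (l + (n - l - 1))" by simp
      with False show ?thesis by (auto simp: refill_schedule_def image_iff)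
    qed
  qed
  then have "benefit v (unit_config m) ?s = sum ?g (Suc ` {..<l} \<union> (\<lambda>q. Suc (l + q)) ` {..<m})"
    by (simp add: benefit_def)
  also have "\<dots> = sum ?g (Suc ` {..<l}) + sum ?g ((\<lambda>q. Suc (l + q)) ` {..<m})"
    by (rule sum.union_disjoint) auto
  also have "\<dots> = (\<Sum>t<l. ?g (Suc t)) + (\<Sum>q<m. ?g (Suc (l + q)))"
    by (simp add: sum.reindex inj_on_def)
  also have "\<dots> = (\<Sum>t<l. v (Suc (d t))) + (\<Sum>q<m. v (Suc q))"
    using d by (intro arg_cong2[where f = "(+)"] sum.cong)
      (auto simp: refill_schedule_def queue_value_unit_config)
  finally show ?thesis .
qed

section \<open>The benefit of a schedule that rejects all refills\<close>

lemma send_0_refill_input: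
  assumes "feasible C (refill_input m d l) s"
  shows "send s 0 = None"
proof (rule ccontr)
  assume "send s 0 \<noteq> None"
  then obtain q where "send s 0 = Some q" by blast
  with assms have "0 < backlog (refill_input m d l) s q (length (arrived (refill_input m d l) 0)) 0"
    unfolding feasible_def by fastforce
  then show False
    by (simp add: arrived_refill_input_0 backlog_def)
qed

text \<open>The last send event before refill \<open>t\<close> is \<open>Suc t\<close>. Its
  destination still holds the initial packet then, which exhausts the capacity of one.\<close>

lemma refill_rejected:
  assumes feas: "feasible (unit_config m) (refill_input m d l) s"
    and full: "\<And>t. t < l \<Longrightarrow> d t \<in> full_queues m s (Suc t)"
  shows "admit s \<subseteq> {..<m}"
proof
  fix i
  let ?\<sigma> = "refill_input m d l"
  assume i: "i \<in> admit s"
  show "i \<in> {..<m}"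
  proof (rule ccontr)
    assume "i \<notin> {..<m}"
    then obtain t where it: "i = m + t" by (metis le_iff_add lessThan_iff not_less)
    with i feas have t: "t < l" by (auto simp: feasible_def)
    from full[OF t] have d: "d t < m" "d t \<in> admit s" "\<And>n. n \<le> Suc t \<Longrightarrow> send s n \<noteq> Some (d t)"
      by (auto simp: full_queues_def)
    have "backlog ?\<sigma> s (dest (?\<sigma> ! i)) i (arr (?\<sigma> ! i)) < int (capacity (unit_config m ! dest (?\<sigma> ! i)))"
      using i feas by (simp add: feasible_def)
    then have "backlog ?\<sigma> s (d t) i (real t + 3/2) < 1"
      using t d by (simp add: it nth_refill_input capacity_unit_config)
    moreover have "{n. real n < real t + 3/2 \<and> send s n = Some (d t)} = {}"
    proof -
      have "n \<le> Suc t" if "real n < real t + 3/2" for n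
        using that by linarith
      with d(3) show ?thesis by blast
    qed
    moreover have "d t \<in> {j \<in> admit s. j < i \<and> dest (?\<sigma> ! j) = d t}"
      using d t it by (simp add: nth_refill_input)
    then have "card {j \<in> admit s. j < i \<and> dest (?\<sigma> ! j) = d t} > 0"
      by (subst card_gt_0_iff) auto
    ultimately show False
      unfolding backlog_def by (simp only: card.empty)
  qed
qed

lemma benefit_le_full_queues:
  assumes feas: "feasible (unit_config m) (refill_input m d l) s"
    and rejected: "admit s \<subseteq> {..<m}"
    and nonneg: "\<And>q. q < m \<Longrightarrow> 0 \<le> v (Suc q)"
  shows "0 \<le> benefit v (unit_config m) s"
    and "benefit v (unit_config m) s \<le> (\<Sum>q\<in>full_queues m s 0. v (Suc q))"
proof -
  let ?\<sigma> = "refill_input m d l"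
  let ?N = "{n. send s n \<noteq> None}"
  have once: "q \<in> admit s \<and> (\<forall>n'<n. send s n' \<noteq> Some q)" if "send s n = Some q" for n q
  proof -
    let ?k = "length (arrived ?\<sigma> (real n))"
    let ?A = "{j \<in> admit s. j < ?k \<and> dest (?\<sigma> ! j) = q}"
    let ?B = "{n'. real n' < real n \<and> send s n' = Some q}"
    have "0 < backlog ?\<sigma> s q ?k (real n)"
      using that feas unfolding feasible_def by blast
    then have AB: "card ?B < card ?A"
      by (simp add: backlog_def)
    have A: "?A \<subseteq> {q} \<inter> admit s"
      using rejected by (auto simp: nth_refill_input)
    then have "card ?A \<le> 1"
      using card_mono[of "{q}" ?A] by auto
    with AB have "card ?B = 0" by linarith
    moreover have "finite ?B"
      by (rule finite_subset[of _ "{..<n}"]) auto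
    ultimately have "?B = {}" by simp
    moreover from AB have "?A \<noteq> {}"
      by (metis card.empty not_less_zero)
    ultimately show ?thesis using A by auto
  qed
  have inj: "inj_on (\<lambda>n. the (send s n)) ?N"
  proof (rule inj_onI)
    fix n n'
    assume "n \<in> ?N" "n' \<in> ?N" "the (send s n) = the (send s n')"
    then obtain q where q: "send s n = Some q" "send s n' = Some q" by force
    from once[OF q(1)] once[OF q(2)] q show "n = n'"
      by (meson nat_neq_iff)
  qed
  have "full_queues m s 0 = admit s"
    using rejected send_0_refill_input[OF feas] by (auto simp: full_queues_def)
  then have sub: "(\<lambda>n. the (send s n)) ` ?N \<subseteq> full_queues m s 0"
    using once by auto
  have fin: "finite (full_queues m s 0)"
    by (simp add: full_queues_def)
  have lt: "q < m" if "q \<in> full_queues m s 0" for q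
    using that by (simp add: full_queues_def)
  have "benefit v (unit_config m) s =
      (\<Sum>q\<in>(\<lambda>n. the (send s n)) ` ?N. queue_value v (unit_config m) q)"
    unfolding benefit_def by (subst sum.reindex[OF inj]) simp
  also have "\<dots> = (\<Sum>q\<in>(\<lambda>n. the (send s n)) ` ?N. v (Suc q))"
    using sub lt by (intro sum.cong) (auto simp: queue_value_unit_config subset_iff)
  finally have benefit: "benefit v (unit_config m) s =
    (\<Sum>q\<in>(\<lambda>n. the (send s n)) ` ?N. v (Suc q))" .
  show "0 \<le> benefit v (unit_config m) s"
    unfolding benefit using sub lt by (intro sum_nonneg nonneg) (auto simp: subset_iff)
  show "benefit v (unit_config m) s \<le> (\<Sum>q\<in>full_queues m s 0. v (Suc q))"
    unfolding benefit using lt nonneg by (intro sum_mono2[OF fin sub]) auto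
qed

section \<open>Chains of sets losing at most one element per step\<close>

lemma card_decreasing_chain:
  fixes X :: "nat \<Rightarrow> 'a set"
  assumes "\<And>t. finite (X t)" and "\<And>t. \<exists>x. X t - {x} \<subseteq> X (Suc t)"
  shows "card (X 0) \<le> card (X t) + t"
proof (induction t)
  case (Suc t)
  obtain x where "X t - {x} \<subseteq> X (Suc t)" using assms(2) by blast
  then have "card (X t - {x}) \<le> card (X (Suc t))"
    using assms(1) by (intro card_mono)
  then show ?case using Suc card_Diff1_le[of "X t" x] card_Diff_singleton_if[of "X t" x]
    by (auto split: if_splits)
qed simp

text \<open>One element of \<open>S\<close> is charged to \<open>Max S\<close>; the others lie in
  the next set and are charged to the later maxima. The induction is on a subset \<open>S\<close>
  because \<open>X\<close> itself need not shrink at a step, while \<open>S\<close> loses exactly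
  one element.\<close>

lemma sum_Max_decreasing_chain:
  fixes X :: "nat \<Rightarrow> 'a::linorder set" and w :: "'a \<Rightarrow> real"
  assumes fin: "\<And>t. finite (X t)" and step: "\<And>t. \<exists>x. X t - {x} \<subseteq> X (Suc t)"
    and mono: "\<And>t x y. x \<in> X t \<Longrightarrow> y \<in> X t \<Longrightarrow> x \<le> y \<Longrightarrow> w x \<le> w y"
    and S: "S \<subseteq> X 0" "card S = Suc l"
  shows "sum w S \<le> w (Max S) + (\<Sum>t<l. w (Max (X (Suc t))))"
  using assms
proof (induction l arbitrary: X S)
  case 0
  then obtain x where "S = {x}" by (auto simp: card_1_singleton_iff)
  then show ?case by simp
next
  case (Suc l)
  note fin = Suc.prems(1) and step = Suc.prems(2) and mono = Suc.prems(3)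
  have finS: "finite S" and neS: "S \<noteq> {}"
    using Suc.prems(5) by (auto intro: card_ge_0_finite)
  obtain y where y: "X 0 - {y} \<subseteq> X (Suc 0)" using step by blast
  \<comment> \<open>If the lost element \<open>y\<close> lies in \<open>S\<close>, it has to go;
    otherwise all of \<open>S\<close> survives and any element may be dropped.\<close>
  define x where "x = (if y \<in> S then y else Max S)"
  have x: "x \<in> S" using neS finS by (simp add: x_def)
  have sub: "S - {x} \<subseteq> X (Suc 0)" using y Suc.prems(4) by (auto simp: x_def)
  have card: "card (S - {x}) = Suc l" using x finS Suc.prems(5) by simp
  then have ne: "S - {x} \<noteq> {}" by (metis card.empty nat.distinct(1))
  have "sum w (S - {x}) \<le> w (Max (S - {x})) + (\<Sum>t<l. w (Max (X (Suc (Suc t)))))"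
    using fin step mono sub card by (intro Suc.IH[of "\<lambda>t. X (Suc t)"]) blast+
  moreover have "w (Max (S - {x})) \<le> w (Max (X (Suc 0)))"
    using sub ne finS fin[of "Suc 0"]
    by (intro mono[of _ "Suc 0"] Max_mono Max_in subsetD[OF sub]) (auto simp del: Diff_eq_empty_iff)
  moreover have "w x \<le> w (Max S)"
    using x finS Suc.prems(4) Max_in[OF finS neS] by (intro mono[of _ 0]) auto
  moreover have "sum w S = w x + sum w (S - {x})"
    using x finS by (rule sum.remove[rotated])
  moreover have "(\<Sum>t<Suc l. w (Max (X (Suc t)))) =
      w (Max (X (Suc 0))) + (\<Sum>t<l. w (Max (X (Suc (Suc t)))))"
    by (rule sum.lessThan_Suc_shift)
  ultimately show ?case by linarith
qed

section \<open>The adversary against a given online algorithm\<close>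

lemma refill_lower_bound:
  assumes m: "1 \<le> m" and nonneg: "\<And>q. q < m \<Longrightarrow> 0 \<le> v (Suc q)"
    and mono: "\<And>p q. p \<le> q \<Longrightarrow> q < m \<Longrightarrow> v (Suc p) \<le> v (Suc q)"
    and online: "online_algorithm m ALG"
  obtains \<sigma> a where "input_sequence (unit_config m) \<sigma>"
    and "0 \<le> benefit v (unit_config m) (ALG (unit_config m) \<sigma>)"
    and "benefit v (unit_config m) (ALG (unit_config m) \<sigma>) \<le> a"
    and "a \<le> (\<Sum>q<m. v (Suc q))"
    and "ereal ((\<Sum>q<m. v (Suc q)) + (a - v m)) \<le> OPT v (unit_config m) \<sigma>"
    and "ereal (\<Sum>q<m. v (Suc q)) \<le> OPT v (unit_config m) \<sigma>"
proof -
  let ?C = "unit_config m" and ?V = "\<Sum>q<m. v (Suc q)"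
  define full where "full \<sigma> t = full_queues m (ALG ?C \<sigma>) t" for \<sigma> t
  \<comment> \<open>The default 0 keeps \<open>d t\<close> a valid queue, and so the input valid,
    even when no queue is full any more.\<close>
  obtain d where d: "\<And>t. d t = (if full (refill_input m d t) (Suc t) = {} then 0
      else Max (full (refill_input m d t) (Suc t)))"
    using adaptive_refill_exists[of
      "\<lambda>\<sigma> t. if full \<sigma> (Suc t) = {} then 0 else Max (full \<sigma> (Suc t))" m] by blast
  have fin: "finite (full \<sigma> t)" and full_lt: "\<And>q. q \<in> full \<sigma> t \<Longrightarrow> q < m" for \<sigma> t
    by (auto simp: full_def full_queues_def)
  have d_lt: "d t < m" for t
    using d[of t] m full_lt[OF Max_in[OF fin]] by (auto split: if_splits)
  have input: "input_sequence ?C (refill_input m d l)" for l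
    by (rule input_sequence_refill_input[OF d_lt])
  \<comment> \<open>The adversary inspects the run on the input built so far. By the online
    property, the run on any longer input agrees with it up to time \<open>Suc t\<close>.\<close>
  have full_eq: "full (refill_input m d l) u = full (refill_input m d t) u"
    if "t \<le> l" "u \<le> Suc t" for l t u
  proof -
    let ?\<sigma> = "refill_input m d l" and ?\<tau> = "refill_input m d t"
    have "arrived ?\<sigma> (real (Suc t)) = ?\<tau>" "arrived ?\<tau> (real (Suc t)) = ?\<tau>"
      using that by (auto simp only: arrived_refill_input)
    with online input queue_config_unit_config[of m]
    have "(\<forall>i < length ?\<tau>. i \<in> admit (ALG ?C ?\<sigma>) \<longleftrightarrow> i \<in> admit (ALG ?C ?\<tau>)) \<and>
      (\<forall>n. real n \<le> real (Suc t) \<longrightarrow> send (ALG ?C ?\<sigma>) n = send (ALG ?C ?\<tau>) n)"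
      unfolding online_algorithm_def by metis
    with that show ?thesis
      by (auto simp: full_def full_queues_def simp del: of_nat_Suc)
  qed
  define l where "l = card (full (refill_input m d 0) 0) - 1"
  define \<sigma> where "\<sigma> = refill_input m d l"
  have feas: "feasible ?C \<sigma> (ALG ?C \<sigma>)"
    using online input queue_config_unit_config unfolding online_algorithm_def \<sigma>_def by blast
  have step: "\<exists>x. full \<sigma> t - {x} \<subseteq> full \<sigma> (Suc t)" for t
  proof
    \<comment> \<open>If no queue is served, the removed element is arbitrary, but then every full
      queue stays full.\<close>
    show "full \<sigma> t - {the (send (ALG ?C \<sigma>) (Suc t))} \<subseteq> full \<sigma> (Suc t)"
      by (auto simp: full_def full_queues_def le_Suc_eq)
  qed
  have full_0: "full \<sigma> 0 = full (refill_input m d 0) 0"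
    unfolding \<sigma>_def by (rule full_eq) auto
  have dest: "d t = Max (full \<sigma> (Suc t)) \<and> d t \<in> full \<sigma> (Suc t)" if "t < l" for t
  proof -
    \<comment> \<open>As \<open>Suc t\<close> is at most \<open>l\<close>, one less than the initial
      number of full queues, at least one is left and the default is not taken.\<close>
    have "card (full \<sigma> 0) \<le> card (full \<sigma> (Suc t)) + Suc t"
      by (rule card_decreasing_chain[where X = "full \<sigma>", OF fin step])
    then have "full \<sigma> (Suc t) \<noteq> {}"
      using that full_0 by (auto simp: l_def)
    moreover have "full \<sigma> (Suc t) = full (refill_input m d t) (Suc t)"
      unfolding \<sigma>_def using that by (intro full_eq) auto
    ultimately show ?thesis using d[of t] Max_in[OF fin] by auto
  qed
  have rejected: "admit (ALG ?C \<sigma>) \<subseteq> {..<m}"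
    using feas dest unfolding \<sigma>_def full_def by (intro refill_rejected) auto
  define a where "a = (\<Sum>q\<in>full \<sigma> 0. v (Suc q))"
  note benefit = benefit_le_full_queues[OF feas[unfolded \<sigma>_def] rejected[unfolded \<sigma>_def], of v,
      folded \<sigma>_def full_def, folded a_def]
  have a: "a \<le> ?V"
    unfolding a_def using full_lt nonneg by (intro sum_mono2) auto
  have opt: "ereal ((\<Sum>t<l. v (Suc (d t))) + ?V) \<le> OPT v ?C \<sigma>"
  proof -
    have "ereal (benefit v ?C (refill_schedule m d l)) \<le> OPT v ?C \<sigma>"
      unfolding OPT_def \<sigma>_def by (rule SUP_upper) (simp add: feasible_refill_schedule[OF d_lt])
    then show ?thesis by (simp add: benefit_refill_schedule[OF d_lt])
  qed
  have "a - v m \<le> (\<Sum>t<l. v (Suc (d t)))"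
  proof (cases "full \<sigma> 0 = {}")
    case True
    then have "l = 0" using full_0 by (simp add: l_def)
    then show ?thesis using True nonneg[of "m - 1"] m by (simp add: a_def)
  next
    case False
    have "card (full \<sigma> 0) = Suc l"
      using False fin full_0 by (simp add: l_def card_gt_0_iff)
    then have "a \<le> v (Suc (Max (full \<sigma> 0))) + (\<Sum>t<l. v (Suc (Max (full \<sigma> (Suc t)))))"
      unfolding a_def using mono full_lt
      by (intro sum_Max_decreasing_chain[where X = "full \<sigma>", OF fin step]) auto
    moreover have "v (Suc (Max (full \<sigma> 0))) \<le> v m"
      using mono[of "Max (full \<sigma> 0)" "m - 1"] m full_lt[OF Max_in[OF fin False]] by simp
    moreover have "(\<Sum>t<l. v (Suc (Max (full \<sigma> (Suc t))))) = (\<Sum>t<l. v (Suc (d t)))"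
      using dest by (intro sum.cong) auto
    ultimately show ?thesis by linarith
  qed
  then have "ereal (?V + (a - v m)) \<le> OPT v ?C \<sigma>"
    by (intro order_trans[OF _ opt]) simp
  \<comment> \<open>This bound is positive even if the algorithm gains nothing, where the other one
    may vanish.\<close>
  moreover have "ereal ?V \<le> OPT v ?C \<sigma>"
    using nonneg d_lt by (intro order_trans[OF _ opt]) (simp add: sum_nonneg)
  ultimately show thesis
    using that[of \<sigma> a] input benefit nonneg a by (auto simp: \<sigma>_def)
qed

theorem theorem4:
  fixes m :: nat and v :: "nat \<Rightarrow> real"
    and ALG :: "queue list \<Rightarrow> packet list \<Rightarrow> schedule"
  assumes "1 \<le> m"
    and "\<forall>i \<in> {1..m}. 0 \<le> v i"
    and "strict_mono_on {1..m} v"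
    and "(\<Sum>i = 1..m. v i) \<noteq> 0"
    and "online_algorithm m ALG"
  shows "(\<exists>C \<sigma>. queue_config m C \<and> input_sequence C \<sigma> \<and>
            performance_ratio v ALG C \<sigma> \<ge> ereal (2 - v m / (\<Sum>i = 1..m. v i))) \<and>
         competitive_ratio m v ALG \<ge> ereal (2 - v m / (\<Sum>i = 1..m. v i))"
proof -
  let ?C = "unit_config m"
  define V where "V = (\<Sum>i = 1..m. v i)"
  have V: "V = (\<Sum>q<m. v (Suc q))"
    unfolding V_def by (simp add: sum.atLeast1_atMost_eq)
  have nonneg: "0 \<le> v (Suc q)" if "q < m" for q
    using assms(2) that by simp
  have mono: "v (Suc p) \<le> v (Suc q)" if "p \<le> q" "q < m" for p q
    using strict_mono_onD[OF assms(3), of "Suc p" "Suc q"] that by (cases "p = q") auto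
  have V_pos: "V > 0"
    using assms(4) nonneg unfolding V_def[symmetric] V
    by (metis lessThan_iff order_le_less sum_nonneg)
  have vm_le: "v m \<le> V"
    unfolding V_def using assms(1,2) by (intro member_le_sum) auto
  obtain \<sigma> a where \<sigma>: "input_sequence ?C \<sigma>"
    and ben: "0 \<le> benefit v ?C (ALG ?C \<sigma>)" "benefit v ?C (ALG ?C \<sigma>) \<le> a"
    and a: "a \<le> V"
    and opt: "ereal (V + (a - v m)) \<le> OPT v ?C \<sigma>" "ereal V \<le> OPT v ?C \<sigma>"
    using refill_lower_bound[of m v ALG, OF assms(1) nonneg mono assms(5)] unfolding V by metis
  let ?b = "benefit v ?C (ALG ?C \<sigma>)"
  have "ereal (2 - v m / V) \<le> performance_ratio v ALG ?C \<sigma>"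
  \<comment> \<open>For zero benefit the ratio is infinite because the optimum is at least
    \<open>V\<close>, which is positive.\<close>
  proof (cases "?b = 0")
    case True
    have "0 < OPT v ?C \<sigma>"
      using V_pos opt(2) by (metis ereal_less(2) less_le_trans)
    then have "OPT v ?C \<sigma> / 0 = \<infinity>"
      by (simp add: divide_ereal_def)
    then show ?thesis
      unfolding performance_ratio_def True zero_ereal_def[symmetric] by simp
  next
    case False
    with ben have b: "?b > 0" by simp
    with ben have a_pos: "a > 0" by simp
    have "2 - v m / V = 1 + (V - v m) / V"
      using V_pos by (simp add: field_simps)
    also have "\<dots> \<le> 1 + (V - v m) / a"
      using a a_pos vm_le by (intro add_left_mono divide_left_mono) auto
    also have "\<dots> = (V + (a - v m)) / a"
      using a_pos by (simp add: field_simps)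
    also have "\<dots> \<le> (V + (a - v m)) / ?b"
      using b ben vm_le a_pos by (intro divide_left_mono) auto
    finally have "ereal (2 - v m / V) \<le> ereal (V + (a - v m)) / ereal ?b"
      using b by simp
    also have "\<dots> \<le> OPT v ?C \<sigma> / ereal ?b"
      using b opt(1) by (intro ereal_divide_right_mono) auto
    finally show ?thesis by (simp add: performance_ratio_def)
  qed
  then have ratio: "\<exists>C \<sigma>. queue_config m C \<and> input_sequence C \<sigma> \<and>
      ereal (2 - v m / V) \<le> performance_ratio v ALG C \<sigma>"
    using \<sigma> queue_config_unit_config by blast
  \<comment> \<open>Every \<open>c\<close> in the infimum bounds the ratio on this one input from
    above.\<close>
  then have "ereal (2 - v m / V) \<le> competitive_ratio m v ALG"
    unfolding competitive_ratio_def competitive_def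
    by (intro INF_greatest) (blast intro: order_trans)
  with ratio show ?thesis unfolding V_def by blast
qed

end
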